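(* Let $\mathfrak{A}$ be a complex Jordan--Banach algebra, and let $\varphi\colon\mathfrak{A}\to\mathbb{C}$ be a non-zero linear functional. Then the following statements are equivalent: (a) $\varphi(a)\in\text{J-}\sigma(a)$ for all $a\in\mathfrak{A}$. (b) $\varphi$ is unital or admits a unital extension to the unitization of $\mathfrak{A}$ and maps invertible elements in $\mathfrak{A}$ to non-zero complex numbers. (c) $\varphi$ is (Jordan-)multiplicative, that is, $\varphi(a\circ b)=\varphi(a)\varphi(b)$ for all $a,b\in\mathfrak{A}$.
   Context: A complex Jordan--Banach algebra is a complex Banach space $\mathfrak{A}$ with a bilinear product $(a,b)\mapsto a\circ b$ satisfying $\|a\circ b\|\le\|a\|\,\|b\|$, $a\circ b=b\circ a$, and $(a^2\circ b)\circ a=(a\circ b)\circ a^2$ for all $a,b\in\mathfrak{A}$ (where $a^2=a\circ a$). It is unital if there is $\mathbf{1}\in\mathfrak{A}$ with $\mathbf{1}\circ a=a$ for all $a\in\mathfrak{A}$. A functional on a unital algebra is unital if it sends the unit to $1$. In a unital complex Jordan--Banach algebra, an element $a$ is invertible if there is an element $b$ with $a\circ b=\mathbf{1}$ and $a^2\circ b=a$, and the (Jordan-)spectrum of $a$ is $\text{J-}\sigma(a)=\{\lambda\in\mathbb{C}: a-\lambda\mathbf{1}\text{ is not invertible}\}$. The unitization of a non-unital $\mathfrak{A}$ is $\mathfrak{A}\oplus\mathbb{C}\mathbf{1}$ with product $(a+\lambda\mathbf{1})\circ(b+\mu\mathbf{1})=a\circ b+\lambda b+\mu a+\lambda\mu\mathbf{1}$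 and norm $\|a+\lambda\mathbf{1}\|=\|a\|+|\lambda|$; by the standard convention, if $\mathfrak{A}$ is not unital, $\text{J-}\sigma(a)$ is the spectrum of $a$ in the unitization.
   Formalization: For non-unital algebras, (b) asks that the unital linear extension be non-zero on invertible elements of the unitization, since the algebra itself has none and (b) as written would be vacuous (zero product on the complex numbers with the identity functional is a counterexample). *)

theory Defs
  imports "HOL-Analysis.Analysis"
begin

section \<open>Complex Banach spaces\<close>

class complex_banach = banach +
  fixes scaleC :: "complex \<Rightarrow> 'a \<Rightarrow> 'a" (infixr "*\<^sub>C" 75)
  assumes scaleC_add_right: "c *\<^sub>C (x + y) = c *\<^sub>C x + c *\<^sub>C y"
    and scaleC_add_left: "(c + d) *\<^sub>C x = c *\<^sub>C x + d *\<^sub>C x"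
    and scaleC_scaleC: "c *\<^sub>C (d *\<^sub>C x) = (c * d) *\<^sub>C x"
    and scaleC_one: "1 *\<^sub>C x = x"
    and scaleC_of_real: "complex_of_real r *\<^sub>C x = r *\<^sub>R x"
    and norm_scaleC: "norm (c *\<^sub>C x) = cmod c * norm x"

lemma vector_space_scaleC: "vector_space (scaleC :: complex \<Rightarrow> 'a::complex_banach \<Rightarrow> 'a)"
  by unfold_locales (simp_all add: scaleC_add_right scaleC_add_left scaleC_scaleC scaleC_one)

section \<open>Complex Jordan--Banach algebras\<close>

text \<open>Linearity of the product in its second argument follows from commutativity.\<close>

class complex_jordan_banach_algebra = complex_banach +
  fixes jprod :: "'a \<Rightarrow> 'a \<Rightarrow> 'a" (infixl "\<circ>\<^sub>J" 70)
  assumes jprod_add_left: "(a + b) \<circ>\<^sub>J c = a \<circ>\<^sub>J c + b \<circ>\<^sub>J c"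
    and jprod_scaleC_left: "(z *\<^sub>C a) \<circ>\<^sub>J b = z *\<^sub>C (a \<circ>\<^sub>J b)"
    and jprod_commute: "a \<circ>\<^sub>J b = b \<circ>\<^sub>J a"
    and jordan_identity:
      "((a \<circ>\<^sub>J a) \<circ>\<^sub>J b) \<circ>\<^sub>J a = (a \<circ>\<^sub>J b) \<circ>\<^sub>J (a \<circ>\<^sub>J a)"
    and norm_jprod_le: "norm (a \<circ>\<^sub>J b) \<le> norm a * norm b"

definition is_junit :: "'a::complex_jordan_banach_algebra \<Rightarrow> bool" where
  "is_junit e \<longleftrightarrow> (\<forall>a. e \<circ>\<^sub>J a = a)"

definition junital :: "'a::complex_jordan_banach_algebra itself \<Rightarrow> bool" where
  "junital _ \<longleftrightarrow> (\<exists>e::'a. is_junit e)"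

text \<open>Arbitrary if the algebra is not unital.\<close>

definition junit :: "'a::complex_jordan_banach_algebra" where
  "junit = (THE e. is_junit e)"

lemma is_junit_unique:
  assumes "is_junit d" "is_junit e" shows "d = e"
proof -
  have "e = d \<circ>\<^sub>J e" "d = e \<circ>\<^sub>J d"
    using assms by (simp_all add: is_junit_def)
  then show ?thesis using jprod_commute[of d e] by simp
qed

lemma junit_eqI: "is_junit e \<Longrightarrow> junit = e"
  unfolding junit_def by (rule the_equality) (auto intro: is_junit_unique)

definition jinvertible :: "'a::complex_jordan_banach_algebra \<Rightarrow> bool" where
  "jinvertible a \<longleftrightarrow> junital TYPE('a) \<and> (\<exists>b. a \<circ>\<^sub>J b = junit \<and> (a \<circ>\<^sub>J a) \<circ>\<^sub>J b = a)"

section \<open>The unitization\<close>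

text \<open>\<open>Unitization a z\<close> stands for \<open>a + z \<one>\<close>. This is a type of its own, rather than
  \<open>'a \<times> complex\<close>, because the norm is the sum norm and not the Euclidean one.\<close>

datatype 'a unitization = Unitization (alg_part: 'a) (scal_part: complex)

instantiation unitization :: (complex_banach) real_normed_vector
begin

definition "0 = Unitization 0 0"
definition "x + y = Unitization (alg_part x + alg_part y) (scal_part x + scal_part y)"
definition "x - y = Unitization (alg_part x - alg_part y) (scal_part x - scal_part y)"
definition "- x = Unitization (- alg_part x) (- scal_part x)"
definition "r *\<^sub>R x = Unitization (r *\<^sub>R alg_part x) (r *\<^sub>R scal_part x)"
definition "norm x = norm (alg_part x) + cmod (scal_part x)"
definition "sgn x = inverse (norm x) *\<^sub>R (x :: 'a unitization)"
definition "dist x y = norm (x - y :: 'a unitization)"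
definition
  "(uniformity :: ('a unitization \<times> 'a unitization) filter) =
     (INF e\<in>{0<..}. principal {(x, y). dist x y < e})"
definition
  "open (U :: 'a unitization set) \<longleftrightarrow>
     (\<forall>x\<in>U. \<forall>\<^sub>F (x', y) in uniformity. x' = x \<longrightarrow> y \<in> U)"

instance
proof
  fix x y :: "'a unitization" and r :: real
  show "norm (x + y) \<le> norm x + norm y"
    using norm_triangle_ineq[of "alg_part x" "alg_part y"]
      norm_triangle_ineq[of "scal_part x" "scal_part y"]
    by (simp add: norm_unitization_def plus_unitization_def)
  show "norm x = 0 \<longleftrightarrow> x = 0"
    by (cases x) (simp add: norm_unitization_def zero_unitization_def add_nonneg_eq_0_iff)
qed (auto simp: zero_unitization_def plus_unitization_def minus_unitization_def
    uminus_unitization_def scaleR_unitization_def norm_unitization_def sgn_unitization_def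
    dist_unitization_def uniformity_unitization_def open_unitization_def algebra_simps)

end

instance unitization :: (complex_banach) banach
proof
  fix X :: "nat \<Rightarrow> 'a unitization"
  assume X: "Cauchy X"
  have d: "dist x y = dist (alg_part x) (alg_part y) + dist (scal_part x) (scal_part y)"
    for x y :: "'a unitization"
    by (simp add: dist_unitization_def norm_unitization_def minus_unitization_def dist_norm)
  have "Cauchy (\<lambda>n. alg_part (X n))" "Cauchy (\<lambda>n. scal_part (X n))"
    unfolding Cauchy_def
  proof safe
    fix e :: real assume "0 < e"
    then obtain M where M: "\<And>m n. m \<ge> M \<Longrightarrow> n \<ge> M \<Longrightarrow> dist (X m) (X n) < e"
      using X unfolding Cauchy_def by blast
    have "dist (alg_part x) (alg_part y) \<le> dist x y" "dist (scal_part x) (scal_part y) \<le> dist x y"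
      for x y :: "'a unitization"
      by (simp_all add: d)
    with M show "\<exists>M. \<forall>m\<ge>M. \<forall>n\<ge>M. dist (alg_part (X m)) (alg_part (X n)) < e"
      "\<exists>M. \<forall>m\<ge>M. \<forall>n\<ge>M. dist (scal_part (X m)) (scal_part (X n)) < e"
      by (meson order_le_less_trans)+
  qed
  then obtain a z where a: "(\<lambda>n. alg_part (X n)) \<longlonglongrightarrow> a" and z: "(\<lambda>n. scal_part (X n)) \<longlonglongrightarrow> z"
    by (auto simp: Cauchy_convergent_iff convergent_def)
  have "(\<lambda>n. dist (X n) (Unitization a z)) \<longlonglongrightarrow> 0 + 0"
    unfolding d unitization.sel
    by (rule tendsto_add[OF tendsto_dist_iff[THEN iffD1, OF a] tendsto_dist_iff[THEN iffD1, OF z]])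
  then have "X \<longlonglongrightarrow> Unitization a z"
    by (subst tendsto_dist_iff) simp
  then show "convergent X" by (auto simp: convergent_def)
qed

instantiation unitization :: (complex_banach) complex_banach
begin

definition "c *\<^sub>C x = Unitization (c *\<^sub>C alg_part x) (c * scal_part x)"

instance
  by standard
    (simp_all add: scaleC_unitization_def plus_unitization_def scaleR_unitization_def
      norm_unitization_def scaleC_add_right scaleC_add_left scaleC_scaleC scaleC_one
      scaleC_of_real norm_scaleC norm_mult algebra_simps scaleR_conv_of_real)

end

instantiation unitization :: (complex_jordan_banach_algebra) complex_jordan_banach_algebra
begin

definition "x \<circ>\<^sub>J y = Unitization
  (alg_part x \<circ>\<^sub>J alg_part y + scal_part x *\<^sub>C alg_part y + scal_part y *\<^sub>C alg_part x)
  (scal_part x * scal_part y)"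

instance
proof
  fix x y w :: "'a unitization" and c :: complex
  have add_right: "a \<circ>\<^sub>J (b + d) = a \<circ>\<^sub>J b + a \<circ>\<^sub>J d" for a b d :: 'a
    unfolding jprod_commute[of a] by (rule jprod_add_left)
  have scale_right: "a \<circ>\<^sub>J (c *\<^sub>C b) = c *\<^sub>C (a \<circ>\<^sub>J b)" for a b :: 'a and c
    unfolding jprod_commute[of a] by (rule jprod_scaleC_left)
  note linear_simps = scaleC_add_right scaleC_add_left scaleC_scaleC
    jprod_add_left jprod_scaleC_left add_right scale_right
  show "(x + y) \<circ>\<^sub>J w = x \<circ>\<^sub>J w + y \<circ>\<^sub>J w"
    by (simp add: jprod_unitization_def plus_unitization_def linear_simps algebra_simps)
  show "(c *\<^sub>C x) \<circ>\<^sub>J y = c *\<^sub>C (x \<circ>\<^sub>J y)"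
    by (simp add: jprod_unitization_def scaleC_unitization_def linear_simps algebra_simps)
  show "x \<circ>\<^sub>J y = y \<circ>\<^sub>J x"
    by (simp add: jprod_unitization_def jprod_commute[of "alg_part x"] algebra_simps)
  show "((x \<circ>\<^sub>J x) \<circ>\<^sub>J y) \<circ>\<^sub>J x = (x \<circ>\<^sub>J y) \<circ>\<^sub>J (x \<circ>\<^sub>J x)"
  proof (cases x, cases y)
    fix a b :: 'a and l m
    assume x: "x = Unitization a l" and y: "y = Unitization b m"
    obtain s p q r t w where *: "a \<circ>\<^sub>J a = s" "a \<circ>\<^sub>J b = p" "s \<circ>\<^sub>J b = q" "q \<circ>\<^sub>J a = r" "s \<circ>\<^sub>J a = t"
      "p \<circ>\<^sub>J a = w"
      by blast
    have **: "b \<circ>\<^sub>J a = p" "b \<circ>\<^sub>J s = q" "a \<circ>\<^sub>J s = t" "a \<circ>\<^sub>J p = w" "p \<circ>\<^sub>J s = r"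
      using * jordan_identity[of a b] by (metis jprod_commute)+
    show ?thesis
      unfolding x y
      by (simp add: jprod_unitization_def linear_simps * ** ac_simps)
  qed
  have "norm (x \<circ>\<^sub>J y) \<le> (norm (alg_part x) * norm (alg_part y)
      + cmod (scal_part x) * norm (alg_part y) + cmod (scal_part y) * norm (alg_part x))
      + cmod (scal_part x) * cmod (scal_part y)"
    unfolding norm_unitization_def jprod_unitization_def unitization.sel norm_mult
    by (intro add_right_mono order_trans[OF norm_triangle_ineq] add_mono)
      (simp_all add: norm_jprod_le norm_scaleC)
  also have "\<dots> = norm x * norm y"
    by (simp add: norm_unitization_def algebra_simps)
  finally show "norm (x \<circ>\<^sub>J y) \<le> norm x * norm y" .
qed

end

lemma is_junit_unitization: "is_junit (Unitization 0 1 :: 'a::complex_jordan_banach_algebra unitization)"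
proof -
  have 0: "0 *\<^sub>C a = 0" "c *\<^sub>C (0 :: 'a) = 0" for a :: 'a and c
    using scaleC_of_real[of 0 a] scaleC_add_right[of c 0 "0 :: 'a"] by simp_all
  have "0 \<circ>\<^sub>J a = 0" for a :: 'a
    using jprod_add_left[of 0 0 a] by simp
  then show ?thesis
    by (simp add: is_junit_def jprod_unitization_def scaleC_one 0)
qed

lemma junital_unitization: "junital TYPE('a::complex_jordan_banach_algebra unitization)"
  using is_junit_unitization unfolding junital_def by blast

lemma junit_unitization: "(junit :: 'a::complex_jordan_banach_algebra unitization) = Unitization 0 1"
  by (rule junit_eqI[OF is_junit_unitization])

section \<open>Spectrum and functionals\<close>

definition unital_J_spectrum :: "'a::complex_jordan_banach_algebra \<Rightarrow> complex set" where
  "unital_J_spectrum a = {z. \<not> jinvertible (a - z *\<^sub>C junit)}"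

definition J_spectrum :: "'a::complex_jordan_banach_algebra \<Rightarrow> complex set" where
  "J_spectrum a =
     (if junital TYPE('a) then unital_J_spectrum a else unital_J_spectrum (Unitization a 0))"

abbreviation clinear_functional :: "('a::complex_banach \<Rightarrow> complex) \<Rightarrow> bool" where
  "clinear_functional \<equiv> Vector_Spaces.linear scaleC (*)"

definition unital_functional :: "('a::complex_jordan_banach_algebra \<Rightarrow> complex) \<Rightarrow> bool" where
  "unital_functional f \<longleftrightarrow> junital TYPE('a) \<and> f junit = 1"

definition nonzero_on_invertibles :: "('a::complex_jordan_banach_algebra \<Rightarrow> complex) \<Rightarrow> bool" where
  "nonzero_on_invertibles f \<longleftrightarrow> (\<forall>a. jinvertible a \<longrightarrow> f a \<noteq> 0)"

definition jmultiplicative :: "('a::complex_jordan_banach_algebra \<Rightarrow> complex) \<Rightarrow> bool" where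
  "jmultiplicative f \<longleftrightarrow> (\<forall>a b. f (a \<circ>\<^sub>J b) = f a * f b)"

text \<open>No element of a non-unital algebra is invertible, not even in the unitization, where the
  algebra is a proper ideal. In the non-unital case the condition on invertible elements is
  therefore imposed on the extension.\<close>

definition gleason_kahane_zelazko_condition ::
    "('a::complex_jordan_banach_algebra \<Rightarrow> complex) \<Rightarrow> bool" where
  "gleason_kahane_zelazko_condition f \<longleftrightarrow>
     (unital_functional f \<and> nonzero_on_invertibles f) \<or>
     (\<not> junital TYPE('a) \<and>
       (\<exists>g :: 'a unitization \<Rightarrow> complex.
          clinear_functional g \<and> (\<forall>a. g (Unitization a 0) = f a) \<and>
          unital_functional g \<and> nonzero_on_invertibles g))"

end

theory Submission
  imports Defs "HOL-Computational_Algebra.Fundamental_Theorem_Algebra"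
begin

text \<open>The main step is that a unital functional \<open>\<phi>\<close> that does not vanish on invertible elements
  satisfies \<open>\<phi> (a\<^sup>2) = (\<phi> a)\<^sup>2\<close>; polarization then gives multiplicativity, because the product is
  commutative. As in the Roitman--Sternfeld proof of the associative theorem, consider the
  polynomial \<open>p(z) = \<phi> ((1 - z a)\<^sup>n) = \<Sum>\<^sub>k (n choose k) (-z)\<^sup>k \<phi> (a\<^sup>k)\<close>. Since \<open>(1 - z a)\<^sup>n\<close> is
  invertible for \<open>\<bar>z\<bar> \<parallel>a\<parallel> < 1\<close>, the reciprocals of the at most \<open>n\<close> roots of \<open>p\<close> are bounded
  by \<open>\<parallel>a\<parallel>\<close>, so the sum of their squares, which is \<open>n\<^sup>2 (\<phi> a)\<^sup>2 - n (n - 1) \<phi> (a\<^sup>2)\<close>, is at most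
  \<open>n \<parallel>a\<parallel>\<^sup>2\<close> in absolute value. Divide by \<open>n\<^sup>2\<close> and let \<open>n \<rightarrow> \<infinity>\<close>.

  The inverse of \<open>(1 - z a)\<^sup>n\<close> is a power series in \<open>a\<close>. Such series multiply as formal power
  series do because multiplication by \<open>a\<^sup>k\<close> commutes with multiplication by \<open>a\<close>, which follows
  from the linearized Jordan identity by induction on \<open>k\<close>.\<close>

section \<open>Powers in Jordan algebras\<close>

lemma bounded_bilinear_scaleC:
  "bounded_bilinear (scaleC :: complex \<Rightarrow> 'a::complex_banach \<Rightarrow> 'a)"
proof
  fix r :: real and c :: complex and x :: 'a
  show "(r *\<^sub>R c) *\<^sub>C x = r *\<^sub>R c *\<^sub>C x"
    by (simp add: scaleR_conv_of_real scaleC_scaleC flip: scaleC_of_real)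
  show "c *\<^sub>C r *\<^sub>R x = r *\<^sub>R c *\<^sub>C x"
    by (simp add: scaleC_scaleC mult.commute flip: scaleC_of_real)
  show "\<exists>K. \<forall>(c::complex) (x::'a). norm (c *\<^sub>C x) \<le> norm c * norm x * K"
    by (rule exI[of _ 1]) (simp add: norm_scaleC)
qed (simp_all add: scaleC_add_left scaleC_add_right)

interpretation scaleC: bounded_bilinear "scaleC :: complex \<Rightarrow> 'a::complex_banach \<Rightarrow> 'a"
  by (rule bounded_bilinear_scaleC)

lemma jprod_scaleC_right: "a \<circ>\<^sub>J (c *\<^sub>C b) = c *\<^sub>C (a \<circ>\<^sub>J b)"
  using jprod_scaleC_left jprod_commute by metis

text \<open>The norm bound makes multiplication continuous, so that products can later be taken term
  by term in convergent series.\<close>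

lemma bounded_bilinear_jprod:
  "bounded_bilinear (jprod :: 'a::complex_jordan_banach_algebra \<Rightarrow> 'a \<Rightarrow> 'a)"
proof
  fix r :: real and a b c :: 'a
  show "(r *\<^sub>R a) \<circ>\<^sub>J b = r *\<^sub>R (a \<circ>\<^sub>J b)"
    by (simp add: jprod_scaleC_left flip: scaleC_of_real)
  show "a \<circ>\<^sub>J (r *\<^sub>R b) = r *\<^sub>R (a \<circ>\<^sub>J b)"
    by (simp add: jprod_scaleC_right flip: scaleC_of_real)
  show "a \<circ>\<^sub>J (b + c) = a \<circ>\<^sub>J b + a \<circ>\<^sub>J c"
    by (metis jprod_add_left jprod_commute)
  show "\<exists>K. \<forall>a b :: 'a. norm (a \<circ>\<^sub>J b) \<le> norm a * norm b * K"
    by (rule exI[of _ 1]) (simp add: norm_jprod_le)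
qed (simp_all add: jprod_add_left)

interpretation jprod: bounded_bilinear "jprod :: 'a::complex_jordan_banach_algebra \<Rightarrow> 'a \<Rightarrow> 'a"
  by (rule bounded_bilinear_jprod)

text \<open>The part of the Jordan identity for \<open>a + c\<close> that is linear in \<open>c\<close>; subtracting the identity
  for \<open>a - c\<close> removes the quadratic part.\<close>

lemma jordan_identity_linearized:
  fixes a b c :: "'a::complex_jordan_banach_algebra"
  shows "((a \<circ>\<^sub>J a) \<circ>\<^sub>J b) \<circ>\<^sub>J c + 2 *\<^sub>R (a \<circ>\<^sub>J (b \<circ>\<^sub>J (a \<circ>\<^sub>J c)))
       = 2 *\<^sub>R ((a \<circ>\<^sub>J b) \<circ>\<^sub>J (a \<circ>\<^sub>J c)) + (a \<circ>\<^sub>J a) \<circ>\<^sub>J (b \<circ>\<^sub>J c)"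
proof -
  \<comment> \<open>\<open>T1\<close> and \<open>T2\<close> collect the terms of degree one and two
    in \<open>c\<close>. Replacing \<open>c\<close> by \<open>-c\<close> changes the sign of
    \<open>T1\<close> only, so \<open>T1\<close> vanishes.\<close>
  define T1 where "T1 = ((a \<circ>\<^sub>J a) \<circ>\<^sub>J b) \<circ>\<^sub>J c + 2 *\<^sub>R (((a \<circ>\<^sub>J c) \<circ>\<^sub>J b) \<circ>\<^sub>J a)
     - 2 *\<^sub>R ((a \<circ>\<^sub>J b) \<circ>\<^sub>J (a \<circ>\<^sub>J c)) - (c \<circ>\<^sub>J b) \<circ>\<^sub>J (a \<circ>\<^sub>J a)"
  define T2 where "T2 = ((c \<circ>\<^sub>J c) \<circ>\<^sub>J b) \<circ>\<^sub>J a + 2 *\<^sub>R (((a \<circ>\<^sub>J c) \<circ>\<^sub>J b) \<circ>\<^sub>J c)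
     - 2 *\<^sub>R ((c \<circ>\<^sub>J b) \<circ>\<^sub>J (a \<circ>\<^sub>J c)) - (a \<circ>\<^sub>J b) \<circ>\<^sub>J (c \<circ>\<^sub>J c)"
  have ca: "c \<circ>\<^sub>J a = a \<circ>\<^sub>J c" by (rule jprod_commute)
  have "T1 + T2 = 0"
    using jordan_identity[of "a + c" b] jordan_identity[of a b] jordan_identity[of c b]
    unfolding T1_def T2_def
    by (simp add: jprod.add_left jprod.add_right ca algebra_simps scaleR_2)
  moreover have "T2 - T1 = 0"
    using jordan_identity[of "a - c" b] jordan_identity[of a b] jordan_identity[of c b]
    unfolding T1_def T2_def
    by (simp add: jprod.add_left jprod.add_right jprod.diff_left jprod.diff_right ca algebra_simps scaleR_2)
  ultimately have "2 *\<^sub>R T1 = 0"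
    by (simp add: scaleR_2)
  then have "T1 = 0" by simp
  moreover have "((a \<circ>\<^sub>J c) \<circ>\<^sub>J b) \<circ>\<^sub>J a = a \<circ>\<^sub>J (b \<circ>\<^sub>J (a \<circ>\<^sub>J c))"
    "(c \<circ>\<^sub>J b) \<circ>\<^sub>J (a \<circ>\<^sub>J a) = (a \<circ>\<^sub>J a) \<circ>\<^sub>J (b \<circ>\<^sub>J c)"
    by (metis jprod_commute)+
  ultimately show ?thesis unfolding T1_def by (simp add: algebra_simps)
qed

lemma jprod_square_commute:
  "(a \<circ>\<^sub>J a) \<circ>\<^sub>J (a \<circ>\<^sub>J b) = a \<circ>\<^sub>J ((a \<circ>\<^sub>J a) \<circ>\<^sub>J b)"
  using jordan_identity by (metis jprod_commute)

primrec jpow :: "'a::complex_jordan_banach_algebra \<Rightarrow> nat \<Rightarrow> 'a" where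
  "jpow a 0 = junit"
| "jpow a (Suc n) = a \<circ>\<^sub>J jpow a n"

context
  fixes a :: "'a::complex_jordan_banach_algebra"
  assumes unital: "junital TYPE('a)"
begin

lemma junit_left: "junit \<circ>\<^sub>J (b::'a) = b"
  using unital junit_eqI unfolding junital_def is_junit_def by metis

lemma junit_right: "(b::'a) \<circ>\<^sub>J junit = b"
  using junit_left jprod_commute by metis

text \<open>A first case of power-associativity: the square can be moved past each factor
  \<open>a\<close> of the power. It identifies the leading term when the linearized identity is
  applied to a power.\<close>

lemma jprod_square_jpow: "(a \<circ>\<^sub>J a) \<circ>\<^sub>J jpow a n = jpow a (Suc (Suc n))"
  by (induction n) (simp_all add: junit_right jprod_square_commute)

lemma jprod_jpow_commute: "jpow a n \<circ>\<^sub>J (a \<circ>\<^sub>J b) = a \<circ>\<^sub>J (jpow a n \<circ>\<^sub>J b)"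
proof (induction n arbitrary: b rule: induct_nat_012)
  case 0
  then show ?case by (simp add: junit_left)
next
  case 1
  then show ?case by (simp add: junit_right)
next
  case (ge2 n)
  note IH = ge2[unfolded jpow.simps]
  \<comment> \<open>The linearized identity with \<open>b = jpow a n\<close>, solved for its first
    term. On the right only multiplications by \<open>a\<close>, by its square and by lower powers
    occur, and all of these commute with multiplication by \<open>a\<close>.\<close>
  have *: "jpow a (Suc (Suc n)) \<circ>\<^sub>J c = 2 *\<^sub>R ((a \<circ>\<^sub>J jpow a n) \<circ>\<^sub>J (a \<circ>\<^sub>J c))
      + (a \<circ>\<^sub>J a) \<circ>\<^sub>J (jpow a n \<circ>\<^sub>J c) - 2 *\<^sub>R (a \<circ>\<^sub>J (jpow a n \<circ>\<^sub>J (a \<circ>\<^sub>J c)))" for c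
    using jordan_identity_linearized[of a "jpow a n" c]
    by (simp only: jprod_square_jpow eq_diff_eq)
  show ?case
    unfolding * by (simp add: jprod.add_right jprod.diff_right jprod.scaleR_right
      IH jprod_square_commute)
qed

text \<open>The factor \<open>norm junit\<close> appears because the norm of the unit is not
  normalized to 1.\<close>

lemma norm_jpow_le: "norm (jpow a n) \<le> norm (junit :: 'a) * norm a ^ n"
proof (induction n)
  case (Suc n)
  have "norm (jpow a (Suc n)) \<le> norm a * norm (jpow a n)"
    by (simp add: norm_jprod_le)
  also have "\<dots> \<le> norm a * (norm (junit :: 'a) * norm a ^ n)"
    by (intro mult_left_mono Suc) simp
  finally show ?case by (simp add: mult_ac)
qed simp

end

section \<open>Power series in an element\<close>

text \<open>With \<open>r = norm a\<close> this ensures convergence of the series at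
  \<open>a\<close>, and it is stable under products.\<close>

definition fps_abs_summable :: "real \<Rightarrow> complex fps \<Rightarrow> bool" where
  "fps_abs_summable r f \<longleftrightarrow> summable (\<lambda>k. cmod (fps_nth f k) * r ^ k)"

lemma fps_abs_summable_mult:
  assumes "r \<ge> 0" "fps_abs_summable r f" "fps_abs_summable r g"
  shows "fps_abs_summable r (f * g)"
  unfolding fps_abs_summable_def
proof (rule summable_comparison_test'[where N = 0])
  let ?a = "\<lambda>f k. cmod (fps_nth f k) * r ^ k"
  show "summable (\<lambda>k. \<Sum>i\<le>k. ?a f i * ?a g (k - i))"
    using assms unfolding fps_abs_summable_def by (intro summable_Cauchy_product) simp_all
  fix k
  have "norm (cmod (fps_nth (f * g) k) * r ^ k) = cmod (fps_nth (f * g) k) * r ^ k"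
    using assms(1) by simp
  also have "\<dots> \<le> (\<Sum>i\<le>k. cmod (fps_nth f i * fps_nth g (k - i))) * r ^ k"
    unfolding fps_mult_nth atLeast0AtMost using assms(1) by (intro mult_right_mono norm_sum) simp
  also have "\<dots> = (\<Sum>i\<le>k. ?a f i * ?a g (k - i))"
    unfolding sum_distrib_right
  proof (rule sum.cong)
    fix i assume "i \<in> {..k}"
    then have "r ^ k = r ^ i * r ^ (k - i)"
      by (simp flip: power_add)
    then show "cmod (fps_nth f i * fps_nth g (k - i)) * r ^ k = ?a f i * ?a g (k - i)"
      by (simp add: norm_mult)
  qed simp
  finally show "norm (cmod (fps_nth (f * g) k) * r ^ k) \<le> (\<Sum>i\<le>k. ?a f i * ?a g (k - i))" .
qed

lemma fps_abs_summable_fps_of_poly: "fps_abs_summable r (fps_of_poly p)"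
  unfolding fps_abs_summable_def
  by (rule summable_finite[of "{..degree p}"]) (auto simp: coeff_eq_0)

lemma fps_abs_summable_power:
  assumes "r \<ge> 0" "fps_abs_summable r f"
  shows "fps_abs_summable r (f ^ n)"
  using assms fps_abs_summable_fps_of_poly[of r 1]
  by (induction n) (auto intro: fps_abs_summable_mult)

text \<open>The functional calculus at \<open>a\<close>. An infinite sum is meaningful only if it
  converges, hence the summability hypotheses on general series below.\<close>

definition jeval :: "'a::complex_jordan_banach_algebra \<Rightarrow> complex fps \<Rightarrow> 'a" where
  "jeval a f = (\<Sum>k. fps_nth f k *\<^sub>C jpow a k)"

lemma jeval_fps_of_poly:
  assumes "degree p \<le> n"
  shows "jeval a (fps_of_poly p) = (\<Sum>k\<le>n. coeff p k *\<^sub>C jpow a k)"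
  unfolding jeval_def using assms
  by (subst suminf_finite[of "{..n}"]) (auto simp: coeff_eq_0 scaleC.zero_left)

context
  fixes a :: "'a::complex_jordan_banach_algebra"
  assumes unital: "junital TYPE('a)"
begin

lemma summable_jeval:
  assumes "fps_abs_summable (norm a) f"
  shows "summable (\<lambda>k. fps_nth f k *\<^sub>C jpow a k)"
proof (rule summable_comparison_test'[where N = 0])
  show "summable (\<lambda>k. norm (junit::'a) * (cmod (fps_nth f k) * norm a ^ k))"
    using assms unfolding fps_abs_summable_def by (rule summable_mult)
  show "norm (fps_nth f k *\<^sub>C jpow a k) \<le> norm (junit::'a) * (cmod (fps_nth f k) * norm a ^ k)" for k
    using mult_left_mono[OF norm_jpow_le[OF unital, of a k], of "cmod (fps_nth f k)"]
    by (simp add: norm_scaleC mult_ac)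
qed

lemma jeval_add:
  assumes "fps_abs_summable (norm a) f" "fps_abs_summable (norm a) g"
  shows "jeval a (f + g) = jeval a f + jeval a g"
  unfolding jeval_def using suminf_add[OF assms[THEN summable_jeval]]
  by (simp add: scaleC_add_left)

lemma jeval_const_mult:
  assumes "fps_abs_summable (norm a) f"
  shows "jeval a (fps_const c * f) = c *\<^sub>C jeval a f"
  unfolding jeval_def
  using bounded_linear.suminf[OF scaleC.bounded_linear_right summable_jeval[OF assms], of c]
  by (simp add: scaleC_scaleC)

lemma jeval_X_mult:
  assumes "fps_abs_summable (norm a) f"
  shows "jeval a (fps_X * f) = a \<circ>\<^sub>J jeval a f"
proof -
  \<comment> \<open>The constant coefficient of \<open>fps_X * f\<close> is 0, so the first term
    drops out.\<close>
  have "jeval a (fps_X * f) = (\<Sum>k. fps_nth (fps_X * f) (Suc k) *\<^sub>C jpow a (Suc k))"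
    unfolding jeval_def
    using suminf_split_head[OF summable_jeval[OF fps_abs_summable_mult[OF _
          fps_abs_summable_fps_of_poly assms, of "[:0, 1:]"]]]
    by (simp add: scaleC.zero_left fps_of_poly_pCons)
  also have "\<dots> = (\<Sum>k. a \<circ>\<^sub>J (fps_nth f k *\<^sub>C jpow a k))"
    by (simp add: jprod_scaleC_right)
  also have "\<dots> = a \<circ>\<^sub>J jeval a f"
    unfolding jeval_def
    by (rule bounded_linear.suminf[OF jprod.bounded_linear_right summable_jeval[OF assms], symmetric])
  finally show ?thesis .
qed

lemma jeval_commute:
  assumes "fps_abs_summable (norm a) f"
  shows "jeval a f \<circ>\<^sub>J (a \<circ>\<^sub>J b) = a \<circ>\<^sub>J (jeval a f \<circ>\<^sub>J b)"
proof -
  note s = summable_jeval[OF assms]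
  have *: "jeval a f \<circ>\<^sub>J c = (\<Sum>k. (fps_nth f k *\<^sub>C jpow a k) \<circ>\<^sub>J c)" for c
    unfolding jeval_def by (rule bounded_linear.suminf[OF jprod.bounded_linear_left s])
  have "a \<circ>\<^sub>J (jeval a f \<circ>\<^sub>J b) = (\<Sum>k. a \<circ>\<^sub>J ((fps_nth f k *\<^sub>C jpow a k) \<circ>\<^sub>J b))"
    unfolding * by (rule bounded_linear.suminf[OF jprod.bounded_linear_right
          bounded_linear.summable[OF jprod.bounded_linear_left s]])
  also have "\<dots> = jeval a f \<circ>\<^sub>J (a \<circ>\<^sub>J b)"
    unfolding * by (simp add: jprod_scaleC_left jprod_scaleC_right jprod_jpow_commute[OF unital])
  finally show ?thesis ..
qed

lemma jeval_one: "jeval a 1 = junit"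
  using jeval_fps_of_poly[of 1 0 a] by (simp add: scaleC_one)

text \<open>Induction along Horner's scheme, which is why the first factor is a polynomial. In place
  of associativity, \<open>jeval_commute\<close> pulls the factor \<open>a\<close> out of the
  product.\<close>

lemma jeval_poly_mult:
  assumes g: "fps_abs_summable (norm a) g"
  shows "jeval a (fps_of_poly p) \<circ>\<^sub>J jeval a g = jeval a (fps_of_poly p * g)"
proof (induction p)
  case 0
  then show ?case by (simp add: jeval_def scaleC.zero_left jprod.zero_left)
next
  case (pCons c p)
  let ?p = "fps_of_poly p"
  have p: "fps_abs_summable (norm a) ?p" and X: "fps_abs_summable (norm a) fps_X"
    and c: "fps_abs_summable (norm a) (fps_const c)"
    using fps_abs_summable_fps_of_poly[of _ p] fps_abs_summable_fps_of_poly[of _ "[:0, 1:]"]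
      fps_abs_summable_fps_of_poly[of _ "[:c:]"]
    by (simp_all add: fps_of_poly_pCons)
  note mult = fps_abs_summable_mult[OF norm_ge_zero]
  have const: "jeval a (fps_const c) = c *\<^sub>C junit"
    using jeval_const_mult[of 1 c] fps_abs_summable_fps_of_poly[of _ 1] by (simp add: jeval_one)
  have "jeval a (fps_of_poly (pCons c p)) = c *\<^sub>C junit + a \<circ>\<^sub>J jeval a ?p"
    using jeval_add[OF c mult[OF X p]] jeval_X_mult[OF p]
    by (simp add: fps_of_poly_pCons const mult.commute)
  then have "jeval a (fps_of_poly (pCons c p)) \<circ>\<^sub>J jeval a g
      = c *\<^sub>C jeval a g + jeval a g \<circ>\<^sub>J (a \<circ>\<^sub>J jeval a ?p)"
    by (simp add: jprod.add_left jprod_scaleC_left junit_left[OF unital] jprod_commute[of "jeval a g"])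
  also have "\<dots> = c *\<^sub>C jeval a g + a \<circ>\<^sub>J jeval a (?p * g)"
    by (simp only: jeval_commute[OF g] jprod_commute[of "jeval a g" "jeval a ?p"] pCons.IH)
  also have "\<dots> = jeval a (fps_const c * g + fps_X * (?p * g))"
    using jeval_add[OF mult[OF c g] mult[OF X mult[OF p g]]]
      jeval_X_mult[OF mult[OF p g]] jeval_const_mult[OF g]
    by simp
  finally show ?case
    by (simp add: fps_of_poly_pCons algebra_simps)
qed

lemma jinvertible_jeval_power:
  assumes z: "cmod z * norm a < 1"
  shows "jinvertible (jeval a (fps_of_poly ([:1, -z:] ^ n)))"
proof -
  let ?p = "[:1, -z:] ^ n" and ?g = "Abs_fps (\<lambda>k. z ^ k)"
  \<comment> \<open>The geometric series is the formal inverse of 1 - zX.\<close>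
  have "fps_of_poly [:1, -z:] * ?g = 1"
  proof (rule fps_ext)
    fix k
    show "fps_nth (fps_of_poly [:1, -z:] * ?g) k = fps_nth 1 k"
      by (cases k) (simp_all add: fps_of_poly_pCons algebra_simps)
  qed
  then have inv: "fps_of_poly ?p * ?g ^ n = 1"
    by (simp add: fps_of_poly_power flip: power_mult_distrib)
  have "fps_abs_summable (norm a) ?g"
    unfolding fps_abs_summable_def using z
    by (simp add: norm_power summable_geometric flip: power_mult_distrib)
  then have g: "fps_abs_summable (norm a) (?g ^ n)"
    by (intro fps_abs_summable_power) simp_all
  have p: "fps_abs_summable (norm a) (fps_of_poly ?p)"
    by (rule fps_abs_summable_fps_of_poly)
  have "jeval a (fps_of_poly ?p) \<circ>\<^sub>J jeval a (?g ^ n) = junit"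
    by (simp only: jeval_poly_mult[OF g] inv jeval_one)
  \<comment> \<open>Both products become values of a single formal series, and the ring of formal
    series is associative: (p p) g^n = p (p g^n) = p.\<close>
  moreover have "(jeval a (fps_of_poly ?p) \<circ>\<^sub>J jeval a (fps_of_poly ?p)) \<circ>\<^sub>J jeval a (?g ^ n)
      = jeval a (fps_of_poly ?p)"
    by (simp only: jeval_poly_mult[OF p] fps_of_poly_mult[symmetric] jeval_poly_mult[OF g])
      (simp only: fps_of_poly_mult mult.assoc inv mult_1_right)
  ultimately show ?thesis
    unfolding jinvertible_def using unital by blast
qed

end

section \<open>The Gleason--Kahane--Zelazko theorem\<close>

text \<open>Writing \<open>p = \<Prod>\<^sub>i (1 - y\<^sub>i z)\<close>, the quantity bounded here is \<open>\<Sum>\<^sub>i y\<^sub>i\<^sup>2\<close>.\<close>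

lemma power_sum_bound:
  fixes p :: "complex poly" and R :: real
  assumes "coeff p 0 = 1" and "\<And>z. poly p z = 0 \<Longrightarrow> 1 \<le> cmod z * R"
  shows "cmod ((coeff p 1)\<^sup>2 - 2 * coeff p 2) \<le> degree p * R\<^sup>2"
  using assms
proof (induction "degree p" arbitrary: p)
  case 0
  then show ?case by (simp add: coeff_eq_0)
next
  case (Suc n)
  then have "\<not> constant (poly p)"
    by (simp add: constant_degree)
  then obtain z where z: "poly p z = 0"
    using fundamental_theorem_of_algebra by blast
  have z0: "z \<noteq> 0"
    using z Suc.prems(1) by (auto simp: poly_0_coeff_0)
  obtain s where s: "p = [:-z, 1:] * s"
    using z by (metis dvdE poly_eq_0_iff_dvd)
  \<comment> \<open>Dividing by the root and rescaling by \<open>-z\<close> gives a factor 1 - yX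
    and a quotient whose constant coefficient is again 1.\<close>
  define y where "y = 1 / z"
  define q where "q = smult (-z) s"
  have p: "p = [:1, -y:] * q"
    unfolding s q_def y_def using z0 by (simp add: smult_add_right)
  have q0: "coeff q 0 = 1"
    using Suc.prems(1) unfolding p by simp
  then have "q \<noteq> 0" by auto
  moreover have "y \<noteq> 0" using z0 by (simp add: y_def)
  ultimately have deg: "degree p = Suc (degree q)"
    unfolding p by (subst degree_mult_eq) auto
  \<comment> \<open>Roots of \<open>q\<close> are roots of \<open>p\<close>, so the induction
    hypothesis applies.\<close>
  have "cmod ((coeff q 1)\<^sup>2 - 2 * coeff q 2) \<le> degree q * R\<^sup>2"
    using Suc.hyps(2) deg Suc.prems(2) q0 by (intro Suc.hyps(1)) (auto simp: p)
  \<comment> \<open>Here p_1 = q_1 - y and p_2 = q_2 - y q_1; the mixed terms cancel.\<close>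
  moreover have "(coeff p 1)\<^sup>2 - 2 * coeff p 2 = ((coeff q 1)\<^sup>2 - 2 * coeff q 2) + y\<^sup>2"
    unfolding p using q0
    by (simp add: numeral_2_eq_2 power2_eq_square algebra_simps)
  moreover have "cmod (y\<^sup>2) \<le> R\<^sup>2"
  proof -
    have "cmod y \<le> R"
      using Suc.prems(2)[OF z] z0 by (simp add: y_def norm_divide field_simps)
    then show ?thesis by (simp add: norm_power power_mono)
  qed
  ultimately show ?case
    using norm_triangle_ineq[of "(coeff q 1)\<^sup>2 - 2 * coeff q 2" "y\<^sup>2"]
    by (simp add: deg distrib_right)
qed

section \<open>Linear functionals that do not vanish on invertible elements\<close>

lemma clinear_functional_iff:
  fixes f :: "'a::complex_banach \<Rightarrow> complex"
  shows "clinear_functional f \<longleftrightarrow>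
    (\<forall>x y. f (x + y) = f x + f y) \<and> (\<forall>c x. f (c *\<^sub>C x) = c * f x)"
  using vector_space_scaleC[where 'a = 'a] vector_space_over_itself.vector_space_axioms
  by (auto simp: Vector_Spaces.linear_iff)

lemma clinear_functional_sum:
  assumes "clinear_functional f"
  shows "f (\<Sum>i\<in>A. g i) = (\<Sum>i\<in>A. f (g i))"
  using assms unfolding Vector_Spaces.linear_def by (metis module_hom.sum)

lemma clinear_functional_diff:
  assumes "clinear_functional f"
  shows "f (x - y) = f x - f y"
  using assms by (metis clinear_functional_iff add_diff_cancel diff_add_cancel)

lemma gkz_square:
  fixes f :: "'a::complex_jordan_banach_algebra \<Rightarrow> complex"
  assumes lin: "clinear_functional f" and unit: "unital_functional f"
    and inv: "nonzero_on_invertibles f"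
  shows "f (a \<circ>\<^sub>J a) = (f a)\<^sup>2"
proof -
  have unital: "junital TYPE('a)" and f1: "f junit = 1"
    using unit by (auto simp: unital_functional_def)
  have bound: "cmod (of_nat n * (f a)\<^sup>2 - (of_nat n - 1) * f (a \<circ>\<^sub>J a)) \<le> (norm a)\<^sup>2" if n: "n > 1" for n
  proof -
    define p where "p = (\<Sum>k\<le>n. monom (of_nat (n choose k) * (-1) ^ k * f (jpow a k)) k)"
    have coeff: "coeff p k = of_nat (n choose k) * (-1) ^ k * f (jpow a k)" for k
      unfolding p_def coeff_sum by (simp add: sum.delta binomial_eq_0 not_le)
    have "degree p \<le> n"
      by (rule degree_le) (simp add: coeff)
    have eval: "poly p z = f (jeval a (fps_of_poly ([:1, -z:] ^ n)))" for z
    proof -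
      have "degree ([:1, -z:] ^ n) \<le> n"
        using degree_power_le[of "[:1, -z:]" n] by (auto simp: degree_pCons_eq_if split: if_splits)
      then have "f (jeval a (fps_of_poly ([:1, -z:] ^ n)))
          = (\<Sum>k\<le>n. of_nat (n choose k) * (-z) ^ k * f (jpow a k))"
        using lin by (simp add: jeval_fps_of_poly clinear_functional_sum coeff_linear_poly_power
            clinear_functional_iff)
      also have "\<dots> = poly p z"
        unfolding p_def poly_sum poly_monom
        by (intro sum.cong refl) (simp add: power_minus[of z] mult_ac)
      finally show ?thesis ..
    qed
    \<comment> \<open>Otherwise z is small enough for the power to be invertible, and
      \<open>f\<close> does not vanish there.\<close>
    have root: "1 \<le> cmod z * norm a" if "poly p z = 0" for z
      using that inv jinvertible_jeval_power[OF unital, of z a n]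
      unfolding eval nonzero_on_invertibles_def by force
    have "cmod ((coeff p 1)\<^sup>2 - 2 * coeff p 2) \<le> degree p * (norm a)\<^sup>2"
      by (intro power_sum_bound root) (simp_all add: coeff f1)
    \<comment> \<open>The degree may fall below \<open>n\<close>, since \<open>f (jpow a n)\<close>
      may be 0.\<close>
    also have "\<dots> \<le> n * (norm a)\<^sup>2"
      using \<open>degree p \<le> n\<close> by (intro mult_right_mono) simp_all
    also have "(coeff p 1)\<^sup>2 - 2 * coeff p 2
        = of_nat n * (of_nat n * (f a)\<^sup>2 - (of_nat n - 1) * f (a \<circ>\<^sub>J a))"
    proof -
      have "2 * (n choose 2) = n * (n - 1)"
        unfolding choose_two by (cases n) simp_all
      then have "2 * of_nat (n choose 2) = (of_nat n * (of_nat n - 1) :: complex)"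
        using n by (metis of_nat_mult of_nat_numeral of_nat_diff of_nat_1 less_imp_le)
      moreover have "coeff p 2 = of_nat (n choose 2) * f (a \<circ>\<^sub>J a)"
        by (simp add: coeff junit_right[OF unital] numeral_2_eq_2[THEN arg_cong[where f = "jpow a"]])
      ultimately have "2 * coeff p 2 = of_nat n * (of_nat n - 1) * f (a \<circ>\<^sub>J a)"
        by (simp flip: mult.assoc)
      moreover have "coeff p 1 = - (of_nat n * f a)"
        by (simp add: coeff junit_right[OF unital])
      ultimately show ?thesis
        by (simp add: power2_eq_square algebra_simps)
    qed
    finally show ?thesis
      using n by (simp add: norm_mult)
  qed
  \<comment> \<open>The quantity in \<open>bound\<close> equals n d + f(a^2), so n |d| stays bounded
    as n grows, which forces d = 0.\<close>
  define d where "d = (f a)\<^sup>2 - f (a \<circ>\<^sub>J a)"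
  have d_bound: "real n * cmod d \<le> (norm a)\<^sup>2 + cmod (f (a \<circ>\<^sub>J a))" if "n > 1" for n
  proof -
    have "of_nat n * d = (of_nat n * (f a)\<^sup>2 - (of_nat n - 1) * f (a \<circ>\<^sub>J a)) - f (a \<circ>\<^sub>J a)"
      by (simp add: d_def algebra_simps)
    then have "cmod (of_nat n * d) \<le> (norm a)\<^sup>2 + cmod (f (a \<circ>\<^sub>J a))"
      using bound[OF that] norm_triangle_ineq4 by (smt (verit))
    then show ?thesis by (simp add: norm_mult)
  qed
  have "d = 0"
  proof (rule ccontr)
    assume "d \<noteq> 0"
    then obtain m where "(norm a)\<^sup>2 + cmod (f (a \<circ>\<^sub>J a)) < real m * cmod d"
      using reals_Archimedean3[of "cmod d"] by auto
    \<comment> \<open>The shift by 2 meets the condition \<open>n > 1\<close> of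
      \<open>d_bound\<close>.\<close>
    also have "\<dots> \<le> real (m + 2) * cmod d"
      by (intro mult_right_mono) simp_all
    finally show False
      using d_bound[of "m + 2"] by simp
  qed
  then show ?thesis by (simp add: d_def)
qed

lemma gkz_jmultiplicative:
  fixes f :: "'a::complex_jordan_banach_algebra \<Rightarrow> complex"
  assumes lin: "clinear_functional f" and "unital_functional f" "nonzero_on_invertibles f"
  shows "jmultiplicative f"
  unfolding jmultiplicative_def
proof (intro allI)
  fix a b
  have sq: "f (c \<circ>\<^sub>J c) = (f c)\<^sup>2" for c
    using assms by (rule gkz_square)
  have add: "f (x + y) = f x + f y" for x y
    using lin by (simp add: clinear_functional_iff)
  show "f (a \<circ>\<^sub>J b) = f a * f b"
    using sq[of "a + b"] sq[of a] sq[of b]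
    by (simp add: jprod.add_left jprod.add_right add jprod_commute[of b a]
        power2_eq_square algebra_simps)
qed

section \<open>Multiplicative functionals and the spectrum\<close>

lemma jmultiplicative_unital_spectrum:
  fixes f :: "'a::complex_jordan_banach_algebra \<Rightarrow> complex"
  assumes lin: "clinear_functional f" and nz: "f \<noteq> (\<lambda>_. 0)"
    and unital: "junital TYPE('a)" and mult: "jmultiplicative f"
  shows "f a \<in> unital_J_spectrum a"
proof -
  have m: "f (x \<circ>\<^sub>J y) = f x * f y" for x y
    using mult by (simp add: jmultiplicative_def)
  obtain c where "f c \<noteq> 0" using nz by auto
  then have f1: "f junit = 1"
    using m[of junit c] by (simp add: junit_left[OF unital])
  then have "f (a - f a *\<^sub>C junit) = 0"
    using lin by (simp add: clinear_functional_diff clinear_functional_iff)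
  \<comment> \<open>An inverse \<open>b\<close> would give 0 = 0 * f b = f 1 = 1.\<close>
  then have "\<not> jinvertible (a - f a *\<^sub>C junit)"
    using m f1 unfolding jinvertible_def by (metis mult_zero_left zero_neq_one)
  then show ?thesis by (simp add: unital_J_spectrum_def)
qed

text \<open>For linear \<open>f\<close>, the only linear extension that sends the adjoined unit to
  1.\<close>

definition unitization_extension :: "('a \<Rightarrow> complex) \<Rightarrow> 'a unitization \<Rightarrow> complex" where
  "unitization_extension f x = f (alg_part x) + scal_part x"

lemma clinear_functional_unitization_extension:
  "clinear_functional f \<Longrightarrow> clinear_functional (unitization_extension f)"
  by (simp add: clinear_functional_iff unitization_extension_def plus_unitization_def
      scaleC_unitization_def algebra_simps)

lemma jmultiplicative_unitization_extension:
  assumes "clinear_functional f" "jmultiplicative f"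
  shows "jmultiplicative (unitization_extension f)"
  using assms
  by (simp add: clinear_functional_iff jmultiplicative_def unitization_extension_def
      jprod_unitization_def algebra_simps)

lemma unital_functional_unitization_extension:
  assumes "clinear_functional f"
  shows "unital_functional (unitization_extension f)"
  using clinear_functional_diff[OF assms, of 0 0]
  by (simp add: unital_functional_def junital_unitization junit_unitization unitization_extension_def)

lemma jmultiplicative_J_spectrum:
  fixes f :: "'a::complex_jordan_banach_algebra \<Rightarrow> complex"
  assumes lin: "clinear_functional f" and nz: "f \<noteq> (\<lambda>_. 0)" and mult: "jmultiplicative f"
  shows "f a \<in> J_spectrum a"
proof (cases "junital TYPE('a)")
  case True
  then show ?thesis
    using jmultiplicative_unital_spectrum[OF lin nz _ mult] by (simp add: J_spectrum_def)
next
  case False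
  let ?g = "unitization_extension f"
  have "?g \<noteq> (\<lambda>_. 0)"
    using unital_functional_unitization_extension[OF lin] by (auto simp: unital_functional_def)
  then have "?g (Unitization a 0) \<in> unital_J_spectrum (Unitization a 0)"
    by (intro jmultiplicative_unital_spectrum clinear_functional_unitization_extension
        jmultiplicative_unitization_extension junital_unitization lin mult)
  then show ?thesis
    using False by (simp add: J_spectrum_def unitization_extension_def)
qed

section \<open>The remaining implications, with and without a unit\<close>

lemma J_spectrum_gkz_condition:
  fixes f :: "'a::complex_jordan_banach_algebra \<Rightarrow> complex"
  assumes lin: "clinear_functional f" and spec: "\<And>a. f a \<in> J_spectrum a"
  shows "gleason_kahane_zelazko_condition f"
proof (cases "junital TYPE('a)")
  case True
  then have ninv: "\<not> jinvertible (a - f a *\<^sub>C junit)" for a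
    using spec[of a] by (simp add: J_spectrum_def unital_J_spectrum_def)
  have "f junit = 1"
  proof (rule ccontr)
    \<comment> \<open>If \<open>f junit\<close> differs from 1, then 1 - f(1) 1 is a non-zero
      multiple of the unit, hence invertible, against the spectral hypothesis at the unit.\<close>
    define c where "c = 1 - f junit"
    assume "f junit \<noteq> 1"
    then have c: "c \<noteq> 0" by (simp add: c_def)
    have "(junit :: 'a) - f junit *\<^sub>C junit = c *\<^sub>C junit"
      by (simp add: c_def scaleC.diff_left scaleC_one)
    moreover have "jinvertible (c *\<^sub>C junit :: 'a)"
      unfolding jinvertible_def
      by (intro conjI True exI[of _ "(1 / c) *\<^sub>C junit"])
        (simp_all add: jprod_scaleC_left jprod_scaleC_right junit_left[OF True] scaleC_scaleC
          scaleC_one c)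
    ultimately show False using ninv[of junit] by simp
  qed
  moreover have "f a \<noteq> 0" if "jinvertible a" for a
    using ninv[of a] that by (auto simp: scaleC.zero_left)
  ultimately show ?thesis
    using True by (simp add: gleason_kahane_zelazko_condition_def unital_functional_def
        nonzero_on_invertibles_def)
next
  case False
  let ?g = "unitization_extension f"
  have "?g x \<noteq> 0" if "jinvertible x" for x
  proof
    assume "?g x = 0"
    \<comment> \<open>A kernel element of the extension has the form a - f(a) 1, which is not
      invertible because f(a) lies in the spectrum of a.\<close>
    then have "x = Unitization (alg_part x) 0 - f (alg_part x) *\<^sub>C junit"
      by (cases x) (simp add: unitization_extension_def junit_unitization minus_unitization_def
          scaleC_unitization_def scaleC.zero_right add_eq_0_iff)
    then show False
      using spec[of "alg_part x"] that False by (simp add: J_spectrum_def unital_J_spectrum_def)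
  qed
  then have "clinear_functional ?g \<and> (\<forall>a. ?g (Unitization a 0) = f a) \<and>
      unital_functional ?g \<and> nonzero_on_invertibles ?g"
    by (simp add: clinear_functional_unitization_extension unital_functional_unitization_extension
        lin nonzero_on_invertibles_def) (simp add: unitization_extension_def)
  then show ?thesis
    using False unfolding gleason_kahane_zelazko_condition_def by blast
qed

lemma gkz_condition_jmultiplicative:
  fixes f :: "'a::complex_jordan_banach_algebra \<Rightarrow> complex"
  assumes lin: "clinear_functional f" and "gleason_kahane_zelazko_condition f"
  shows "jmultiplicative f"
  using assms(2) unfolding gleason_kahane_zelazko_condition_def
proof (elim disjE conjE exE)
  assume "unital_functional f" "nonzero_on_invertibles f"
  then show ?thesis by (rule gkz_jmultiplicative[OF lin])
next
  fix g :: "'a unitization \<Rightarrow> complex"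
  assume "clinear_functional g" "unital_functional g" "nonzero_on_invertibles g"
    and g: "\<forall>a. g (Unitization a 0) = f a"
  then have g_mult: "g (x \<circ>\<^sub>J y) = g x * g y" for x y
    using gkz_jmultiplicative unfolding jmultiplicative_def by blast
  \<comment> \<open>The embedded algebra is closed under the product of the unitization, so
    multiplicativity restricts from \<open>g\<close> to \<open>f\<close>.\<close>
  have "f (a \<circ>\<^sub>J b) = f a * f b" for a b
    using g_mult[of "Unitization a 0" "Unitization b 0"] g
    by (simp add: jprod_unitization_def scaleC.zero_left)
  then show ?thesis by (simp add: jmultiplicative_def)
qed

theorem theorem3p2:
  fixes \<phi> :: "'a::complex_jordan_banach_algebra \<Rightarrow> complex"
  assumes "clinear_functional \<phi>"
    and "\<phi> \<noteq> (\<lambda>_. 0)"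
  shows "((\<forall>a. \<phi> a \<in> J_spectrum a) \<longleftrightarrow> gleason_kahane_zelazko_condition \<phi>) \<and>
         (gleason_kahane_zelazko_condition \<phi> \<longleftrightarrow> jmultiplicative \<phi>)"
  using assms J_spectrum_gkz_condition gkz_condition_jmultiplicative jmultiplicative_J_spectrum
  by metis

end
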